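(* Consider the system $x_{t+1}=Ax_t+Bu_t+w_t$ and a prediction horizon of length $N\ge1$. At each time step $t$, if $x_t\in\bar x_{t|t}\oplus\mathcal E$ and the $k$-step ahead nominal state predictions $\bar x_{t+k|t}$ satisfy $$g_j^T\bar x_{t+k|t}\le h_j-\gamma_j-f(\alpha_j)\sqrt{g_j^T\Sigma_wg_j}$$ for all $j=1,\dots,n_x$ and $k=1,\dots,N$, where $\gamma_j=\max_{e\in\mathcal E}g_j^TA_{cl}e$ and $f(\alpha_j)=\sqrt{\frac{1-\alpha_j}{\alpha_j}}$, then the $k$-step ahead predictions $x_{t+k|t}$ of the actual state satisfy $$\mathbb P\left(g_j^Tx_{t+k|t}\le h_j\right)\ge1-\alpha_j$$ for all $j=1,\dots,n_x$ and $k=1,\dots,N$.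
   Context: Setting. $x_t\in\mathbb R^n$, $u_t\in\mathbb R^m$. The noise $(w_t)_{t\ge0}$ is i.i.d., with a distribution supported on $\mathcal W=\{w\in\mathbb R^n:\|w\|_\infty\le a_w\}$, $a_w>0$, with mean $\mathbb Ew_t=0$ and covariance $\Sigma_w=\mathbb E w_tw_t^T$. The data are $g_j\in\mathbb R^n$, $h_j\in\mathbb R$, $\alpha_j\in(0,1)$ for $j=1,\dots,n_x$. $K\in\mathbb R^{m\times n}$ is a gain such that $A_{cl}=A+BK$ is stable (all eigenvalues strictly inside the unit disc). Sets. $\oplus$ is the Minkowski sum (with $x\oplus S=\{x\}\oplus S$). $\mathcal E$ is the minimum robust invariant set for $e^+=A_{cl}e+w$, $w\in\mathcal W$: the closed set satisfying $A_{cl}\mathcal E\oplus\mathcal W\subseteq\mathcal E$ that is contained in every closed set with this property. Predictions. At time $t$ the state $x_t$ is measured and the nominal sequences are fixed (non-random relative to the future noise). The nominal predictions satisfy $\bar x_{t+k+1|t}=A\bar x_{t+k|t}+B\bar u_{t+k|t}$ for $k=0,\dots,N-1$. The actual predictions are $x_{t+k|t}=\bar x_{t+k|t}+e_{t+k|t}$, with $x_{t|t}=x_t$, $e_{t|t}=x_t-\bar x_{t|t}$ and $e_{t+k+1|t}=A_{cl}e_{t+k|t}+w_{t+k|t}$. This corresponds to inputs $K(x_{t+k|t}-\bar x_{t+k|t})+\bar u_{t+k|t}$. Here $w_{t|t},\dots,w_{t+N-1|t}$ are i.i.d. with the noise distribution, and the probability is over these. *)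

theory Defs
  imports "HOL-Analysis.Analysis" "HOL-Probability.Probability"
begin

text \<open>Stability of a real matrix refers to its complex eigenvalues, so the matrix is
  first regarded as a complex one.\<close>

definition complex_eigenvalue :: "real^'n^'n \<Rightarrow> complex \<Rightarrow> bool" where
  "complex_eigenvalue A z \<longleftrightarrow>
     (\<exists>v::complex^'n. v \<noteq> 0 \<and> map_matrix complex_of_real A *v v = z *s v)"

definition stable_matrix :: "real^'n^'n \<Rightarrow> bool" where
  "stable_matrix A \<longleftrightarrow> (\<forall>z. complex_eigenvalue A z \<longrightarrow> cmod z < 1)"

definition noise_set :: "real \<Rightarrow> (real^'n) set" where
  "noise_set a = {w. infnorm w \<le> a}"

definition bounded_noise_law :: "real \<Rightarrow> (real^'n) measure \<Rightarrow> bool" where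
  "bounded_noise_law a D \<longleftrightarrow>
     prob_space D \<and> sets D = sets borel \<and> (AE w in D. w \<in> noise_set a) \<and> (\<integral>w. w \<partial>D) = 0"

text \<open>The second-moment matrix, written entrywise; it is the covariance of a law
  with mean zero.\<close>

definition noise_cov :: "(real^'n) measure \<Rightarrow> real^'n^'n" where
  "noise_cov D = (\<chi> i j. \<integral>w. w $ i * w $ j \<partial>D)"

definition iid_noise ::
  "'o measure \<Rightarrow> (real^'n) measure \<Rightarrow> nat set \<Rightarrow> (nat \<Rightarrow> 'o \<Rightarrow> real^'n) \<Rightarrow> bool" where
  "iid_noise M D I w \<longleftrightarrow>
     prob_space M \<and> prob_space.indep_vars M (\<lambda>_. borel) w I \<and>
     (\<forall>i\<in>I. distr M borel (w i) = D)"

text \<open>Here \<open>+\<close> on sets is the Minkowski sum. Nonemptiness is required because the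
  empty set is closed and trivially satisfies the inclusion, so that it would otherwise
  be the minimum.\<close>

definition robust_invariant :: "real^'n^'n \<Rightarrow> (real^'n) set \<Rightarrow> (real^'n) set \<Rightarrow> bool" where
  "robust_invariant Acl W S \<longleftrightarrow> closed S \<and> S \<noteq> {} \<and> ((*v) Acl ` S) + W \<subseteq> S"

definition minimum_robust_invariant ::
  "real^'n^'n \<Rightarrow> (real^'n) set \<Rightarrow> (real^'n) set \<Rightarrow> bool" where
  "minimum_robust_invariant Acl W E \<longleftrightarrow>
     robust_invariant Acl W E \<and> (\<forall>S. robust_invariant Acl W S \<longrightarrow> E \<subseteq> S)"

text \<open>A maximum, not a supremum: \<^const>\<open>Greatest\<close> picks the largest element of the image.\<close>

definition tightening :: "real^'n^'n \<Rightarrow> (real^'n) set \<Rightarrow> real^'n \<Rightarrow> real" where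
  "tightening Acl E g = (GREATEST y. y \<in> (\<lambda>e. g \<bullet> (Acl *v e)) ` E)"

definition cantelli_factor :: "real \<Rightarrow> real" where
  "cantelli_factor \<alpha> = sqrt ((1 - \<alpha>) / \<alpha>)"

primrec pred_error ::
  "real^'n^'n \<Rightarrow> real^'n \<Rightarrow> (nat \<Rightarrow> real^'n) \<Rightarrow> nat \<Rightarrow> real^'n" where
  "pred_error Acl e0 w 0 = e0"
| "pred_error Acl e0 w (Suc k) = Acl *v pred_error Acl e0 w k + w k"

text \<open>The \<open>k\<close>-step ahead prediction of the actual state, given the measured state \<open>x\<close>, the
  nominal predictions \<open>xbar\<close> and the future noise \<open>w\<close>.\<close>

definition pred_state ::
  "real^'n^'n \<Rightarrow> real^'n \<Rightarrow> (nat \<Rightarrow> real^'n) \<Rightarrow> (nat \<Rightarrow> real^'n) \<Rightarrow> nat \<Rightarrow> real^'n" where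
  "pred_state Acl x xbar w k = xbar k + pred_error Acl (x - xbar 0) w k"

end

(* After a first step the error splits as e_k = Acl e_(k-1) + w_(k-1). Almost surely e_(k-1) stays
   in E, so g . Acl e_(k-1) is at most the tightening, and the remaining scalar g . w_(k-1) has mean
   zero and variance g . Sigma g, so Cantelli's one-sided inequality bounds its upper tail.

   That the maximum defining the tightening exists needs E to be compact. The resolvent
   (1 - z Acl)^-1 is holomorphic on a disc of radius larger than 1, by Cramer's rule and stability, so
   its Taylor coefficients Acl^n are absolutely summable. Hence the closure of the states reachable
   from 0 is a bounded robust invariant set, and E is contained in it. *)

theory Submission
  imports Defs "HOL-Complex_Analysis.Complex_Analysis"
begin

unbundle no Formal_Power_Series.fps_syntax

section \<open>Powers of a stable matrix\<close>

lemma holomorphic_on_det [holomorphic_intros]: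
  fixes F :: "complex \<Rightarrow> complex^'n^'n"
  assumes "\<And>i j. (\<lambda>z. F z $ i $ j) holomorphic_on S"
  shows "(\<lambda>z. det (F z)) holomorphic_on S"
  unfolding det_def by (intro holomorphic_intros assms)

text \<open>The matrix \<open>I - z A\<close> over the complex numbers; its inverse is the
  generating function of the powers of \<open>A\<close>.\<close>

definition resolvent_matrix :: "real^'n^'n \<Rightarrow> complex \<Rightarrow> complex^'n^'n" where
  "resolvent_matrix A z = (\<chi> i j. (if i = j then 1 else 0) - z * complex_of_real (A $ i $ j))"

lemma resolvent_matrix_mult:
  "(resolvent_matrix A z *v v) $ i = v $ i - z * (\<Sum>j\<in>UNIV. complex_of_real (A $ i $ j) * v $ j)"
proof -
  have "(resolvent_matrix A z *v v) $ i
      = (\<Sum>j\<in>UNIV. (if i = j then v $ j else 0) - z * (complex_of_real (A $ i $ j) * v $ j))"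
    unfolding matrix_vector_mult_def resolvent_matrix_def by (auto simp: algebra_simps intro!: sum.cong)
  then show ?thesis by (simp add: sum_subtractf sum_distrib_left)
qed

text \<open>A nonzero kernel vector satisfies \<open>v = z A v\<close>, so \<open>z\<close> is
  nonzero and \<open>1 / z\<close> is an eigenvalue of modulus at least 1, against
  stability.\<close>

lemma stable_det_resolvent_nonzero:
  assumes "stable_matrix A" and "norm z \<le> 1"
  shows "det (resolvent_matrix A z) \<noteq> 0"
proof
  assume "det (resolvent_matrix A z) = 0"
  then have "\<not> invertible (resolvent_matrix A z)"
    by (simp add: invertible_det_nz)
  then obtain v where v: "v \<noteq> 0" "resolvent_matrix A z *v v = 0"
    unfolding invertible_left_inverse matrix_left_invertible_ker by blast
  have eq: "z * (\<Sum>j\<in>UNIV. complex_of_real (A $ i $ j) * v $ j) = v $ i" for i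
    using arg_cong[OF v(2), of "\<lambda>u. u $ i"] by (simp add: resolvent_matrix_mult)
  then have "z \<noteq> 0"
    using v(1) by (auto simp: vec_eq_iff)
  then have "map_matrix complex_of_real A *v v = (1 / z) *s v"
    using eq by (simp add: vec_eq_iff matrix_vector_mult_def nonzero_eq_divide_eq mult.commute)
  then have "norm (1 / z) < 1"
    using assms(1) v(1) unfolding stable_matrix_def complex_eigenvalue_def by blast
  then show False
    using assms(2) \<open>z \<noteq> 0\<close> by (simp add: norm_divide divide_simps)
qed

text \<open>The closed unit disc is compact and the nonvanishing set of the determinant is open, so
  there is a margin around the disc. It places the point 1 strictly inside a disc of
  holomorphy.\<close>

lemma stable_resolvent_disc:
  assumes "stable_matrix A"
  shows "\<exists>R>1. \<forall>z. norm z < R \<longrightarrow> det (resolvent_matrix A z) \<noteq> 0"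
proof -
  let ?U = "{z. det (resolvent_matrix A z) \<noteq> 0}"
  have "(\<lambda>z. det (resolvent_matrix A z)) holomorphic_on UNIV"
    by (intro holomorphic_intros) (auto simp: resolvent_matrix_def intro!: holomorphic_intros)
  then have "continuous_on UNIV (\<lambda>z. det (resolvent_matrix A z))"
    by (rule holomorphic_on_imp_continuous_on)
  then have "open ?U"
    by (intro open_Collect_neq) auto
  have "cball 0 1 \<subseteq> ?U"
    using stable_det_resolvent_nonzero[OF assms] by auto
  then obtain \<epsilon> where \<epsilon>: "\<epsilon> > 0" "(\<Union>z\<in>cball 0 1. ball z \<epsilon>) \<subseteq> ?U"
    by (rule compact_subset_open_imp_ball_epsilon_subset[OF compact_cball \<open>open ?U\<close>])
  have "det (resolvent_matrix A z) \<noteq> 0" if "norm z < 1 + \<epsilon>" for z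
  proof -
    \<comment> \<open>Shrinking \<open>z\<close> radially gives a point of the open unit disc whose
      distance to \<open>z\<close> is \<open>\<epsilon> * norm y\<close>, hence below
      \<open>\<epsilon>\<close>.\<close>
    define y where "y = z / of_real (1 + \<epsilon>)"
    have z: "z = of_real (1 + \<epsilon>) * y"
    proof -
      have "complex_of_real (1 + \<epsilon>) \<noteq> 0"
        using \<epsilon>(1) by (simp only: of_real_eq_0_iff)
      then show ?thesis by (metis y_def times_divide_eq_right nonzero_mult_div_cancel_left)
    qed
    have "norm y < 1"
      using that \<epsilon>(1) unfolding y_def norm_divide norm_of_real by (simp add: divide_simps)
    moreover have "dist y z = \<epsilon> * norm y"
      using \<epsilon>(1) by (simp add: z dist_norm ring_distribs norm_mult)
    ultimately have "z \<in> (\<Union>z\<in>cball 0 1. ball z \<epsilon>)"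
      using \<epsilon>(1) by (intro UN_I[of y]) auto
    then show ?thesis using \<epsilon>(2) by blast
  qed
  then show ?thesis
    using \<epsilon>(1) by (intro exI[of _ "1 + \<epsilon>"]) simp
qed

lemma stable_summable_powers:
  fixes A :: "real^'n^'n"
  assumes "stable_matrix A"
  shows "summable (\<lambda>n. norm ((((*v) A) ^^ n) v))"
proof -
  obtain R where R: "R > 1" "\<And>z. norm z < R \<Longrightarrow> det (resolvent_matrix A z) \<noteq> 0"
    using stable_resolvent_disc[OF assms] by blast
  define b :: "complex^'n" where "b = (\<chi> i. complex_of_real (v $ i))"
  \<comment> \<open>Cramer's quotient: \<open>f k z\<close> is coordinate \<open>k\<close> of the
    solution of the linear system with matrix \<open>resolvent_matrix A z\<close> and right-hand
    side \<open>b\<close>.\<close>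
  define f where "f k z =
    det (\<chi> i j. if j = k then b $ i else resolvent_matrix A z $ i $ j) / det (resolvent_matrix A z)" for k z
  define F where "F k = fps_expansion (f k) 0" for k
  have f_holo: "f k holomorphic_on ball 0 R" for k
    unfolding f_def
  proof (intro holomorphic_intros)
    show "(\<lambda>z. resolvent_matrix A z $ i $ j) holomorphic_on ball 0 R" for i j
      by (auto simp: resolvent_matrix_def intro!: holomorphic_intros)
    show "(\<lambda>z. (\<chi> i j. if j = k then b $ i else resolvent_matrix A z $ i $ j) $ i $ j)
        holomorphic_on ball 0 R" for i j
      by (cases "j = k") (auto simp: resolvent_matrix_def intro!: holomorphic_intros)
  qed (use R in auto)
  have F: "f k has_fps_expansion F k" for k
    unfolding F_def using R(1) by (intro has_fps_expansion_fps_expansion[OF _ _ f_holo]) auto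
  have f_eq: "f i z = b $ i + z * (\<Sum>j\<in>UNIV. complex_of_real (A $ i $ j) * f j z)"
    if "norm z < R" for i z
  proof -
    have "resolvent_matrix A z *v (\<chi> k. f k z) = b"
      unfolding f_def using cramer[OF R(2)[OF that]] by blast
    from arg_cong[OF this, of "\<lambda>u. u $ i"] show ?thesis
      by (simp add: resolvent_matrix_mult algebra_simps)
  qed
  \<comment> \<open>The identity \<open>f_eq\<close> near 0 passes to formal power series because an
    expansion at 0 is unique.\<close>
  have F_eq: "F i = fps_const (b $ i)
      + fps_X * (\<Sum>j\<in>UNIV. fps_const (complex_of_real (A $ i $ j)) * F j)" for i
  proof (rule fps_expansion_unique_complex[OF F])
    have "eventually (\<lambda>z. z \<in> ball 0 R) (nhds (0::complex))"
      using R(1) by (intro eventually_nhds_in_open) auto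
    then have ev: "eventually (\<lambda>z. f i z = b $ i + z * (\<Sum>j\<in>UNIV. complex_of_real (A $ i $ j) * f j z)) (nhds 0)"
      by eventually_elim (rule f_eq, simp)
    show "f i has_fps_expansion
      fps_const (b $ i) + fps_X * (\<Sum>j\<in>UNIV. fps_const (complex_of_real (A $ i $ j)) * F j)"
      unfolding has_fps_expansion_cong[OF ev refl] by (intro fps_expansion_intros F)
  qed
  have mult_nth: "(A *v u) $ i = (\<Sum>j\<in>UNIV. A $ i $ j * u $ j)" for u i
    by (simp add: matrix_vector_mult_def)
  \<comment> \<open>Comparing coefficients in \<open>F_eq\<close> gives a recursion: the constant
    term is \<open>v\<close>, and each later coefficient vector is \<open>A\<close> applied to the
    one before.\<close>
  have coeff: "fps_nth (F i) n = complex_of_real (((((*v) A) ^^ n) v) $ i)" for i n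
  proof (induction n arbitrary: i)
    case 0
    show ?case by (subst F_eq) (simp add: b_def)
  next
    case (Suc n)
    have "fps_nth (F i) (Suc n) = (\<Sum>j\<in>UNIV. complex_of_real (A $ i $ j) * fps_nth (F j) n)"
      by (subst F_eq) (simp add: fps_sum_nth)
    also have "\<dots> = complex_of_real (\<Sum>j\<in>UNIV. A $ i $ j * ((((*v) A) ^^ n) v) $ j)"
      by (simp add: Suc)
    also have "\<dots> = complex_of_real (((((*v) A) ^^ Suc n) v) $ i)"
      unfolding funpow.simps comp_apply mult_nth ..
    finally show ?case .
  qed
  have "summable (\<lambda>n. \<bar>((((*v) A) ^^ n) v) $ i\<bar>)" for i
  proof -
    \<comment> \<open>Absolute convergence is taken at the point 1, where the terms of the series
      are the coefficients themselves.\<close>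
    have "ereal (norm (1::complex)) < ereal R"
      using R(1) by simp
    also have "ereal R \<le> fps_conv_radius (F i)"
      using f_holo[of i] by (intro holomorphic_on_imp_fps_conv_radius_ge[OF F]) simp
    finally have "ereal (norm (1::complex)) < fps_conv_radius (F i)" .
    from abs_summable_in_conv_radius[OF this[unfolded fps_conv_radius_def]] show ?thesis
      by (simp only: coeff power_one mult_1_right norm_of_real)
  qed
  then have "summable (\<lambda>n. \<Sum>i\<in>UNIV. \<bar>((((*v) A) ^^ n) v) $ i\<bar>)"
    by (intro summable_sum)
  moreover have "norm (norm u) \<le> (\<Sum>i\<in>UNIV. \<bar>u $ i\<bar>)" for u :: "real^'n"
    unfolding real_norm_def abs_norm_cancel by (rule norm_le_l1_cart)
  ultimately show ?thesis
    by (rule summable_comparison_test'[where N = 0])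
qed

section \<open>The minimum robust invariant set is bounded\<close>

lemma linear_funpow:
  fixes f :: "'a::real_vector \<Rightarrow> 'a"
  assumes "linear f"
  shows "linear (f ^^ n)"
proof (induction n)
  case (Suc n)
  show ?case
    unfolding funpow.simps by (rule linear_compose[OF Suc assms])
qed (simp add: linear_id[unfolded id_def] id_def)

text \<open>The closure of the states reachable from 0 works: a disturbance \<open>n\<close> steps
  old is weighted by the \<open>n\<close>-th power of \<open>A\<close>, and these weights are
  summable.\<close>

lemma bounded_robust_invariant_exists:
  fixes A :: "real^'n^'n"
  assumes "stable_matrix A" "bounded W"
  shows "\<exists>S. robust_invariant A W S \<and> bounded S"
proof (cases "W = {}")
  case True
  then have "robust_invariant A W {0}"
    by (simp add: robust_invariant_def set_plus_def)
  then show ?thesis using bounded_insert by blast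
next
  case False
  let ?P = "\<lambda>n. ((*v) A) ^^ n"
  \<comment> \<open>\<open>s (k, v)\<close> is the state reached from 0 after \<open>k\<close>
    steps, with the disturbances listed backwards: \<open>v 0\<close> is the most recent.\<close>
  define s where "s = (\<lambda>(k, v). \<Sum>i<k. ?P i (v i))"
  define T where "T = s ` (UNIV \<times> (UNIV \<rightarrow> W))"
  obtain a where a: "\<And>x. x \<in> W \<Longrightarrow> norm x \<le> a"
    using assms(2) unfolding bounded_iff by blast
  have lin: "linear (?P n)" for n
    by (intro linear_funpow) simp
  \<comment> \<open>Up to the factor \<open>a\<close>, this sum of norms of basis images bounds the
    \<open>n\<close>-th power on all of \<open>W\<close>, since each coordinate of a point of
    \<open>W\<close> is at most \<open>a\<close> in absolute value.\<close>
  define c where "c n = (\<Sum>b\<in>Basis. norm (?P n b))" for n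
  have c: "summable c"
    unfolding c_def by (intro summable_sum stable_summable_powers assms)
  have c_nonneg: "c n \<ge> 0" for n
    unfolding c_def by (intro sum_nonneg) simp
  have P_le: "norm (?P n x) \<le> a * c n" if "x \<in> W" for n x
  proof -
    have "?P n x = ?P n (\<Sum>b\<in>Basis. (x \<bullet> b) *\<^sub>R b)"
      by (simp only: euclidean_representation)
    also have "\<dots> = (\<Sum>b\<in>Basis. (x \<bullet> b) *\<^sub>R ?P n b)"
      by (simp add: linear_sum[OF lin] linear_scale[OF lin])
    also have "norm \<dots> \<le> (\<Sum>b\<in>Basis. a * norm (?P n b))"
    proof (rule sum_norm_le)
      fix b :: "real^'n" assume "b \<in> Basis"
      then have "\<bar>x \<bullet> b\<bar> \<le> a"
        using Basis_le_norm a[OF that] order_trans by blast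
      then show "norm ((x \<bullet> b) *\<^sub>R ?P n b) \<le> a * norm (?P n b)"
        by (simp add: mult_right_mono)
    qed
    finally show ?thesis by (simp add: c_def sum_distrib_left)
  qed
  have "a \<ge> 0"
    using a False norm_ge_zero order_trans by (metis ex_in_conv)
  have "norm y \<le> a * suminf c" if yT: "y \<in> T" for y
  proof -
    obtain k v where y: "y = (\<Sum>i<k. ?P i (v i))" and v: "\<And>i. v i \<in> W"
      using yT unfolding T_def s_def by auto
    have "norm y \<le> (\<Sum>i<k. a * c i)"
      unfolding y by (intro sum_norm_le P_le v)
    also have "\<dots> \<le> a * suminf c"
      unfolding sum_distrib_left[symmetric]
      by (intro mult_left_mono sum_le_suminf c \<open>a \<ge> 0\<close>) (auto simp: c_nonneg)
    finally show ?thesis .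
  qed
  then have "bounded T"
    unfolding bounded_iff by blast
  have step: "A *v y + x \<in> T" if yT: "y \<in> T" and x: "x \<in> W" for x y
  proof -
    obtain k v where y: "y = (\<Sum>i<k. ?P i (v i))" and v: "\<And>i. v i \<in> W"
      using yT unfolding T_def s_def by auto
    \<comment> \<open>Applying \<open>A\<close> raises every power by one, which frees index 0 for
      the new disturbance \<open>x\<close>.\<close>
    have "A *v y + x = s (Suc k, case_nat x v)"
      unfolding s_def y by (simp add: sum.lessThan_Suc_shift linear_sum del: sum.lessThan_Suc)
    moreover have "case_nat x v \<in> UNIV \<rightarrow> W"
      using v x by (auto split: nat.split)
    ultimately show ?thesis unfolding T_def by blast
  qed
  have "((*v) A ` closure T) + W \<subseteq> closure T"
  proof (clarsimp simp: set_plus_def)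
    fix y x assume "y \<in> closure T" "x \<in> W"
    \<comment> \<open>For a fixed disturbance the step is a continuous map sending \<open>T\<close>
      into \<open>T\<close>, so it also preserves the closure.\<close>
    have "(\<lambda>y. A *v y + x) ` closure T \<subseteq> closure T"
      using step[OF _ \<open>x \<in> W\<close>] closure_subset
      by (intro image_closure_subset continuous_intros) auto
    then show "A *v y + x \<in> closure T"
      using \<open>y \<in> closure T\<close> by blast
  qed
  moreover have "T \<noteq> {}"
    unfolding T_def using False by (auto simp: Pi_eq_empty)
  ultimately show ?thesis
    using bounded_closure[OF \<open>bounded T\<close>] unfolding robust_invariant_def by (intro exI[of _ "closure T"]) auto
qed

text \<open>Minimality puts \<open>E\<close> inside the bounded invariant set just constructed, and
  \<open>E\<close> is closed by definition.\<close>

lemma minimum_robust_invariant_compact: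
  assumes "stable_matrix A" "bounded W" "minimum_robust_invariant A W E"
  shows "compact E"
proof -
  have "closed E"
    using assms(3) by (simp add: minimum_robust_invariant_def robust_invariant_def)
  moreover obtain S where "robust_invariant A W S" "bounded S"
    using bounded_robust_invariant_exists[OF assms(1,2)] by blast
  then have "bounded E"
    using assms(3) bounded_subset unfolding minimum_robust_invariant_def by blast
  ultimately show ?thesis by (simp add: compact_eq_bounded_closed)
qed

section \<open>The noise box and the tightening constant\<close>

lemma bounded_noise_set: "bounded (noise_set a :: (real^'n) set)"
proof -
  have "norm x \<le> sqrt DIM(real^'n) * a" if "x \<in> noise_set a" for x :: "real^'n"
    using that order_trans[OF norm_le_infnorm mult_left_mono]
    unfolding noise_set_def by (metis (mono_tags) mem_Collect_eq of_nat_0_le_iff real_sqrt_ge_zero)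
  then show ?thesis unfolding bounded_iff by blast
qed

lemma closed_noise_set: "closed (noise_set a)"
  unfolding noise_set_def by (intro closed_Collect_le continuous_intros)

text \<open>\<open>GREATEST\<close> is informative only once a largest value is known to exist; on a
  compact set the continuous function attains it.\<close>

lemma tightening_upper:
  assumes "compact E" "e \<in> E"
  shows "g \<bullet> (Acl *v e) \<le> tightening Acl E g"
proof -
  have "continuous_on E (\<lambda>e. g \<bullet> (Acl *v e))"
    by (intro continuous_intros)
  with assms obtain m where m: "m \<in> E" "\<And>y. y \<in> E \<Longrightarrow> g \<bullet> (Acl *v y) \<le> g \<bullet> (Acl *v m)"
    using continuous_attains_sup[of E] by blast
  then have "tightening Acl E g = g \<bullet> (Acl *v m)"
    unfolding tightening_def by (intro Greatest_equality) auto
  then show ?thesis using m(2)[OF assms(2)] by simp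
qed

section \<open>Cantelli's inequality\<close>

text \<open>Markov's inequality is applied to the square of the shifted variable
  \<open>X + s\<close>, with the shift chosen to make the bound sharpest.\<close>

lemma (in prob_space) Cantelli_inequality:
  assumes X [measurable]: "integrable M X" "integrable M (\<lambda>\<omega>. (X \<omega>)\<^sup>2)"
    and "expectation X = 0" "l > 0"
  defines "V \<equiv> expectation (\<lambda>\<omega>. (X \<omega>)\<^sup>2)"
  shows "prob {\<omega> \<in> space M. X \<omega> \<ge> l} \<le> V / (V + l\<^sup>2)"
proof -
  \<comment> \<open>This shift minimises \<open>(V + s^2) / (l + s)^2\<close> over nonnegative
    \<open>s\<close>.\<close>
  define s where "s = V / l"
  have "V \<ge> 0" unfolding V_def by simp
  then have "s \<ge> 0" using \<open>l > 0\<close> unfolding s_def by simp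
  have eq: "(\<lambda>\<omega>. (X \<omega> + s)\<^sup>2) = (\<lambda>\<omega>. (X \<omega>)\<^sup>2 + 2 * s * X \<omega> + s\<^sup>2)"
    by (auto simp: power2_eq_square algebra_simps)
  have int: "integrable M (\<lambda>\<omega>. (X \<omega> + s)\<^sup>2)"
    unfolding eq using X by (intro Bochner_Integration.integrable_add) auto
  have "prob {\<omega> \<in> space M. X \<omega> \<ge> l} \<le> prob {\<omega> \<in> space M. (X \<omega> + s)\<^sup>2 \<ge> (l + s)\<^sup>2}"
    using \<open>l > 0\<close> \<open>s \<ge> 0\<close> by (intro finite_measure_mono) (auto intro!: power_mono)
  also have "\<dots> \<le> expectation (\<lambda>\<omega>. (X \<omega> + s)\<^sup>2) / (l + s)\<^sup>2"
    using \<open>l > 0\<close> \<open>s \<ge> 0\<close> by (intro integral_Markov_inequality_measure[where A = "{}"] int) auto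
  \<comment> \<open>The cross term \<open>2 * s * X\<close> has expectation zero.\<close>
  also have "expectation (\<lambda>\<omega>. (X \<omega> + s)\<^sup>2) = V + s\<^sup>2"
    unfolding eq V_def using X assms(3) by (simp add: prob_space)
  also have "(V + s\<^sup>2) / (l + s)\<^sup>2 = V / (V + l\<^sup>2)"
  proof -
    have pos: "V + l\<^sup>2 > 0" using \<open>V \<ge> 0\<close> \<open>l > 0\<close> by (simp add: add_nonneg_pos)
    have "V + s\<^sup>2 = V * (V + l\<^sup>2) / l\<^sup>2" "(l + s)\<^sup>2 = (V + l\<^sup>2)\<^sup>2 / l\<^sup>2"
      using \<open>l > 0\<close> unfolding s_def by (simp_all add: field_simps power2_eq_square)
    then show ?thesis using pos \<open>l > 0\<close> by (simp add: power2_eq_square)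
  qed
  finally show ?thesis .
qed

text \<open>The factor solves \<open>V / (V + l^2) = \<alpha>\<close> for \<open>l\<close> when
  \<open>V > 0\<close>, so Cantelli's bound on the upper tail becomes exactly
  \<open>\<alpha>\<close>.\<close>

lemma (in prob_space) cantelli_factor_quantile:
  assumes X [measurable]: "integrable M X" "integrable M (\<lambda>\<omega>. (X \<omega>)\<^sup>2)"
    and "expectation X = 0" "0 < \<alpha>" "\<alpha> < 1"
  shows "prob {\<omega> \<in> space M. X \<omega> \<le> cantelli_factor \<alpha> * sqrt (expectation (\<lambda>\<omega>. (X \<omega>)\<^sup>2))} \<ge> 1 - \<alpha>"
proof -
  define V where "V = expectation (\<lambda>\<omega>. (X \<omega>)\<^sup>2)"
  define l where "l = cantelli_factor \<alpha> * sqrt V"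
  have "V \<ge> 0" unfolding V_def by simp
  show ?thesis
  proof (cases "V = 0")
    \<comment> \<open>With zero variance the threshold \<open>l\<close> is 0 and Cantelli's
      inequality does not apply, but \<open>X\<close> vanishes almost surely.\<close>
    case True
    then have "AE \<omega> in M. (X \<omega>)\<^sup>2 = 0"
      unfolding V_def by (subst (asm) integral_nonneg_eq_0_iff_AE) (use X in auto)
    then have "AE \<omega> in M. X \<omega> \<le> l"
      by eventually_elim (use True in \<open>simp add: l_def\<close>)
    then have "prob {\<omega> \<in> space M. X \<omega> \<le> l} = 1"
      by (subst prob_Collect_eq_1) auto
    then show ?thesis
      using \<open>0 < \<alpha>\<close> by (simp add: l_def V_def)
  next
    case False
    then have "V > 0" using \<open>V \<ge> 0\<close> by simp
    then have "l > 0" using assms unfolding l_def cantelli_factor_def by simp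
    have "l\<^sup>2 = (1 - \<alpha>) / \<alpha> * V"
      using assms \<open>V > 0\<close> unfolding l_def cantelli_factor_def by (simp add: power_mult_distrib)
    then have "V + l\<^sup>2 = V / \<alpha>"
      using assms by (simp add: field_simps)
    then have "prob {\<omega> \<in> space M. X \<omega> \<ge> l} \<le> \<alpha>"
      using Cantelli_inequality[OF X assms(3) \<open>l > 0\<close>] \<open>V > 0\<close> by (simp flip: V_def)
    moreover have "1 - prob {\<omega> \<in> space M. X \<omega> \<ge> l} = prob (space M - {\<omega> \<in> space M. X \<omega> \<ge> l})"
      by (rule prob_compl[symmetric]) simp
    moreover have "\<dots> \<le> prob {\<omega> \<in> space M. X \<omega> \<le> l}"
      by (intro finite_measure_mono) auto
    ultimately show ?thesis by (simp add: l_def V_def)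
  qed
qed

section \<open>One step of bounded noise\<close>

text \<open>The support is bounded almost surely and the measure is finite, so first and second
  moments exist. The variance of the projection follows by expanding the square into products of
  coordinates.\<close>

lemma bounded_noise_law_moments:
  fixes D :: "(real^'n) measure"
  assumes "bounded_noise_law a D"
  shows "integrable D (\<lambda>w. g \<bullet> w)" "(\<integral>w. g \<bullet> w \<partial>D) = 0"
    and "integrable D (\<lambda>w. (g \<bullet> w)\<^sup>2)" "(\<integral>w. (g \<bullet> w)\<^sup>2 \<partial>D) = g \<bullet> (noise_cov D *v g)"
proof -
  interpret prob_space D using assms by (simp add: bounded_noise_law_def)
  have [measurable_cong, simp]: "sets D = sets borel"
    using assms by (simp add: bounded_noise_law_def)
  have AE: "AE w in D. w \<in> noise_set a" and mean: "(\<integral>w. w \<partial>D) = 0"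
    using assms by (auto simp: bounded_noise_law_def)
  obtain c where c: "\<And>w::real^'n. w \<in> noise_set a \<Longrightarrow> norm w \<le> c"
    using bounded_noise_set[of a, where 'n = 'n] unfolding bounded_iff by blast
  have id: "integrable D (\<lambda>w. w)"
    by (rule integrable_const_bound[of _ c]) (use AE in \<open>auto elim!: eventually_mono intro: c\<close>)
  then show "integrable D (\<lambda>w. g \<bullet> w)" "(\<integral>w. g \<bullet> w \<partial>D) = 0"
    using mean by auto
  have prod: "integrable D (\<lambda>w. w $ i * w $ j)" for i j
  proof (rule integrable_const_bound[of _ "c * c"])
    show "AE w in D. norm (w $ i * w $ j) \<le> c * c"
      using AE
    proof eventually_elim
      case (elim w)
      then show ?case
        unfolding real_norm_def abs_mult
        by (intro mult_mono order_trans[OF component_le_norm_cart c] order_trans[OF norm_ge_zero c]) auto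
    qed
  qed measurable
  have eq: "(g \<bullet> w)\<^sup>2 = (\<Sum>i\<in>UNIV. \<Sum>j\<in>UNIV. g $ i * g $ j * (w $ i * w $ j))" for w
    by (simp add: inner_vec_def power2_eq_square sum_product mult_ac)
  show "integrable D (\<lambda>w. (g \<bullet> w)\<^sup>2)"
    unfolding eq using prod by (intro Bochner_Integration.integrable_sum) auto
  have "(\<integral>w. (g \<bullet> w)\<^sup>2 \<partial>D) = (\<Sum>i\<in>UNIV. \<Sum>j\<in>UNIV. g $ i * g $ j * (\<integral>w. w $ i * w $ j \<partial>D))"
    unfolding eq using prod by (simp add: Bochner_Integration.integral_sum)
  also have "\<dots> = g \<bullet> (noise_cov D *v g)"
    by (simp add: inner_vec_def matrix_vector_mult_def noise_cov_def sum_distrib_left mult_ac)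
  finally show "(\<integral>w. (g \<bullet> w)\<^sup>2 \<partial>D) = g \<bullet> (noise_cov D *v g)" .
qed

section \<open>The error trajectory along the prediction horizon\<close>

lemma pred_error_measurable:
  assumes "\<And>i. i < k \<Longrightarrow> w i \<in> borel_measurable M"
  shows "(\<lambda>\<eta>. pred_error Acl e0 (\<lambda>i. w i \<eta>) k) \<in> borel_measurable M"
  using assms
proof (induction k)
  case (Suc k)
  have "(\<lambda>\<eta>. Acl *v pred_error Acl e0 (\<lambda>i. w i \<eta>) k) \<in> borel_measurable M"
    using Suc by (intro borel_measurable_continuous_on[of "(*v) Acl"] continuous_intros) auto
  then show ?case using Suc.prems by simp
qed simp

text \<open>Only the first \<open>k\<close> disturbances enter the error at step \<open>k\<close>,
  so noise bounds within the horizon suffice for the induction.\<close>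

lemma pred_error_robust_invariant:
  assumes "robust_invariant Acl W E" "e0 \<in> E" "\<And>i. i < k \<Longrightarrow> w i \<in> W"
  shows "pred_error Acl e0 w k \<in> E"
  using assms(3)
proof (induction k)
  case (Suc k)
  then show ?case
    using assms(1) unfolding robust_invariant_def by (auto simp: set_plus_def subset_iff)
qed (use assms in simp)

section \<open>The chance constraints for the predicted state\<close>

theorem lemma1:
  fixes A :: "real^'n^'n" and B :: "real^'m^'n" and K :: "real^'n^'m"
    and a\<^sub>w :: real and D :: "(real^'n) measure" and E :: "(real^'n) set"
    and n\<^sub>x N :: nat and g :: "nat \<Rightarrow> real^'n" and h \<alpha> :: "nat \<Rightarrow> real"
    and \<Omega> :: "'o measure" and w :: "nat \<Rightarrow> 'o \<Rightarrow> real^'n"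
    and x :: "nat \<Rightarrow> 'o \<Rightarrow> real^'n" and u :: "nat \<Rightarrow> 'o \<Rightarrow> real^'m" and \<omega> :: 'o
    and xbar :: "nat \<Rightarrow> nat \<Rightarrow> real^'n" and ubar :: "nat \<Rightarrow> nat \<Rightarrow> real^'m"
    and M :: "'p measure" and wp :: "nat \<Rightarrow> nat \<Rightarrow> 'p \<Rightarrow> real^'n"
  defines "Acl \<equiv> A + B ** K"
  assumes "a\<^sub>w > 0" and "bounded_noise_law a\<^sub>w D"
    and "\<And>j. j \<in> {1..n\<^sub>x} \<Longrightarrow> 0 < \<alpha> j \<and> \<alpha> j < 1"
    and "stable_matrix Acl"
    and "minimum_robust_invariant Acl (noise_set a\<^sub>w) E"
    and "iid_noise \<Omega> D UNIV w"
    and "\<And>t \<xi>. \<xi> \<in> space \<Omega> \<Longrightarrow> x (Suc t) \<xi> = A *v x t \<xi> + B *v u t \<xi> + w t \<xi>"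
    and "\<omega> \<in> space \<Omega>"
    and "N \<ge> 1"
    and "\<And>t k. k < N \<Longrightarrow> xbar t (Suc k) = A *v xbar t k + B *v ubar t k"
    and "\<And>t. iid_noise M D {..<N} (wp t)"
  shows "\<forall>t. x t \<omega> \<in> {xbar t 0} + E \<and>
      (\<forall>j\<in>{1..n\<^sub>x}. \<forall>k\<in>{1..N}.
         g j \<bullet> xbar t k \<le> h j - tightening Acl E (g j)
           - cantelli_factor (\<alpha> j) * sqrt (g j \<bullet> (noise_cov D *v g j)))
    \<longrightarrow> (\<forall>j\<in>{1..n\<^sub>x}. \<forall>k\<in>{1..N}.
         \<P>(\<eta> in M. g j \<bullet> pred_state Acl (x t \<omega>) (xbar t) (\<lambda>i. wp t i \<eta>) k \<le> h j) \<ge> 1 - \<alpha> j)"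
proof (intro allI impI ballI)
  fix t j k
  assume "x t \<omega> \<in> {xbar t 0} + E \<and>
      (\<forall>j\<in>{1..n\<^sub>x}. \<forall>k\<in>{1..N}.
         g j \<bullet> xbar t k \<le> h j - tightening Acl E (g j)
           - cantelli_factor (\<alpha> j) * sqrt (g j \<bullet> (noise_cov D *v g j)))"
    and j: "j \<in> {1..n\<^sub>x}" and k: "k \<in> {1..N}"
  then have e0: "x t \<omega> - xbar t 0 \<in> E"
    and nominal: "g j \<bullet> xbar t k \<le> h j - tightening Acl E (g j)
      - cantelli_factor (\<alpha> j) * sqrt (g j \<bullet> (noise_cov D *v g j))"
    by (auto simp: set_plus_def)
  \<comment> \<open>Since \<open>k\<close> is at least 1 there is a last disturbance,
    \<open>wp t i\<close>. It is handled by Cantelli's inequality, the earlier ones by invariance of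
    \<open>E\<close>.\<close>
  obtain i where i: "k = Suc i" "i < N"
    using k by (cases k) auto
  let ?W = "noise_set a\<^sub>w :: (real^'n) set"
  let ?c = "cantelli_factor (\<alpha> j) * sqrt (g j \<bullet> (noise_cov D *v g j))"
  note noise = \<open>bounded_noise_law a\<^sub>w D\<close>
  have "compact E"
    using minimum_robust_invariant_compact[OF \<open>stable_matrix Acl\<close> bounded_noise_set
        \<open>minimum_robust_invariant Acl ?W E\<close>] .
  have inv: "robust_invariant Acl ?W E"
    using \<open>minimum_robust_invariant Acl ?W E\<close> by (simp add: minimum_robust_invariant_def)
  interpret D: prob_space D
    using noise by (simp add: bounded_noise_law_def)
  have sets_D [measurable_cong, simp]: "sets D = sets borel"
    using noise by (simp add: bounded_noise_law_def)
  have iid: "iid_noise M D {..<N} (wp t)" by fact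
  interpret M: prob_space M
    using iid by (simp add: iid_noise_def)
  have meas: "wp t l \<in> borel_measurable M" and law: "distr M borel (wp t l) = D" if "l < N" for l
    using iid that by (auto simp: iid_noise_def M.indep_vars_def)
  have "AE \<eta> in M. wp t l \<eta> \<in> ?W" if "l < N" for l
  proof -
    have "AE v in distr M borel (wp t l). v \<in> ?W"
      using noise unfolding law[OF that] bounded_noise_law_def by blast
    then show ?thesis
      by (subst (asm) AE_distr_iff) (use meas[OF that] borel_closed[OF closed_noise_set] in auto)
  qed
  then have AE_noise: "AE \<eta> in M. \<forall>l\<in>{..<N}. wp t l \<eta> \<in> ?W"
    by (intro AE_finite_allI) auto
  \<comment> \<open>The quantile bound is first proved under \<open>D\<close> for the projection
    \<open>g j \<bullet> v\<close>, and then carried to \<open>M\<close>, where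
    \<open>wp t i\<close> has law \<open>D\<close>.\<close>
  have "1 - \<alpha> j \<le> D.prob {v \<in> space D. g j \<bullet> v \<le> ?c}"
    using D.cantelli_factor_quantile[OF bounded_noise_law_moments(1,3,2)[OF noise], of "\<alpha> j" "g j"]
      \<open>\<And>j. j \<in> {1..n\<^sub>x} \<Longrightarrow> 0 < \<alpha> j \<and> \<alpha> j < 1\<close>[OF j]
    unfolding bounded_noise_law_moments(4)[OF noise] by blast
  also have "\<dots> = measure (distr M borel (wp t i)) {v \<in> space D. g j \<bullet> v \<le> ?c}"
    by (simp only: law[OF i(2)])
  also have "\<dots> = M.prob {\<eta> \<in> space M. g j \<bullet> wp t i \<eta> \<le> ?c}"
    by (subst measure_distr)
      (use meas[OF i(2)] sets_eq_imp_space_eq[OF sets_D] in \<open>auto intro!: arg_cong[of _ _ M.prob]\<close>)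
  \<comment> \<open>The inclusion of events holds only almost surely: the earlier disturbances must
    lie in the noise box to keep the error in \<open>E\<close>.\<close>
  also have "\<dots> \<le> \<P>(\<eta> in M. g j \<bullet> pred_state Acl (x t \<omega>) (xbar t) (\<lambda>i. wp t i \<eta>) k \<le> h j)"
  proof (rule M.finite_measure_mono_AE)
    have [measurable]: "(\<lambda>\<eta>. pred_error Acl (x t \<omega> - xbar t 0) (\<lambda>i. wp t i \<eta>) k) \<in> borel_measurable M"
      using meas i by (intro pred_error_measurable) auto
    show "{\<eta> \<in> space M. g j \<bullet> pred_state Acl (x t \<omega>) (xbar t) (\<lambda>i. wp t i \<eta>) k \<le> h j} \<in> sets M"
      unfolding pred_state_def by measurable
    show "AE \<eta> in M. \<eta> \<in> {\<eta> \<in> space M. g j \<bullet> wp t i \<eta> \<le> ?c} \<longrightarrow>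
        \<eta> \<in> {\<eta> \<in> space M. g j \<bullet> pred_state Acl (x t \<omega>) (xbar t) (\<lambda>i. wp t i \<eta>) k \<le> h j}"
      using AE_noise
    proof eventually_elim
      case (elim \<eta>)
      define e where "e = pred_error Acl (x t \<omega> - xbar t 0) (\<lambda>i. wp t i \<eta>) i"
      have "e \<in> E"
        unfolding e_def using elim i by (intro pred_error_robust_invariant[OF inv e0]) auto
      then have "g j \<bullet> (Acl *v e) \<le> tightening Acl E (g j)"
        by (rule tightening_upper[OF \<open>compact E\<close>])
      moreover have "pred_state Acl (x t \<omega>) (xbar t) (\<lambda>i. wp t i \<eta>) k = xbar t k + (Acl *v e + wp t i \<eta>)"
        by (simp add: pred_state_def e_def i(1))
      \<comment> \<open>The two margins in \<open>nominal\<close> absorb one term each: the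
        tightening covers \<open>Acl *v e\<close>, the Cantelli margin covers
        \<open>wp t i \<eta>\<close>.\<close>
      ultimately show ?case
        using nominal by (auto simp: inner_add_right)
    qed
  qed
  finally show "1 - \<alpha> j \<le> \<P>(\<eta> in M. g j \<bullet> pred_state Acl (x t \<omega>) (xbar t) (\<lambda>i. wp t i \<eta>) k \<le> h j)" .
qed

end
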